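(* Let $R$ be a commutative ring with unity and let $M$ be an $R$-module with $\operatorname{Spec}(M)\neq\emptyset$. Then $\widetilde{\operatorname{Spec}(M)}$ is a $T_0$-space if and only if $(P:M)\neq(Q:M)$ for all distinct prime submodules $P,Q\in\operatorname{Spec}(M)$.
   Context: For a submodule $N$ of an $R$-module $M$, $(N:M)=\{r\in R : rM\subseteq N\}$. A proper submodule $P$ of $M$ is prime if whenever $rm\in P$ with $r\in R$, $m\in M$, then $m\in P$ or $r\in(P:M)$; in this case $(P:M)$ is a prime ideal of $R$. $\operatorname{Spec}(M)$ is the set of all prime submodules of $M$. A subset $T\subseteq R$ is multiplicatively closed if $1\in T$ and $xy\in T$ whenever $x,y\in T$. For a family $\mathcal{S}=\{S_i\}_{i\in I}$ of multiplicatively closed subsets of $R$, $\widetilde{V}(\mathcal{S})=\{P\in\operatorname{Spec}(M) \mid (P:M)\cap S_i\neq\emptyset \text{ for all } i\in I\}$. $\widetilde{\operatorname{Spec}(M)}$ denotes the set $\operatorname{Spec}(M)$ with the topology whose closed sets are exactly the sets $\widetilde{V}(\mathcal{S})$, $\mathcal{S}$ ranging over all families of multiplicatively closed subsets of $R$. A topological space is $T_0$ if for any two distinct points there is an open set containing precisely one of them. *)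

theory Defs
  imports "HOL-Algebra.Module" "HOL-Algebra.Ideal" "HOL-Analysis.Abstract_Topological_Spaces"
begin

definition submodule_colon ::
    "('a, 'c) ring_scheme \<Rightarrow> ('a, 'b, 'd) module_scheme \<Rightarrow> 'b set \<Rightarrow> 'a set" where
  "submodule_colon R M N = {r \<in> carrier R. \<forall>m\<in>carrier M. r \<odot>\<^bsub>M\<^esub> m \<in> N}"

definition prime_submodule ::
    "('a, 'c) ring_scheme \<Rightarrow> ('a, 'b, 'd) module_scheme \<Rightarrow> 'b set \<Rightarrow> bool" where
  "prime_submodule R M P \<longleftrightarrow>
     submodule P R M \<and> P \<noteq> carrier M \<and>
     (\<forall>r\<in>carrier R. \<forall>m\<in>carrier M. r \<odot>\<^bsub>M\<^esub> m \<in> P \<longrightarrow> m \<in> P \<or> r \<in> submodule_colon R M P)"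

definition module_Spec ::
    "('a, 'c) ring_scheme \<Rightarrow> ('a, 'b, 'd) module_scheme \<Rightarrow> 'b set set" where
  "module_Spec R M = {P. prime_submodule R M P}"

text \<open>
  A multiplicatively closed subset \<open>T\<close> of \<open>R\<close> is a submonoid of the multiplicative monoid of \<open>R\<close>,
  i.e. \<open>submonoid T R\<close>; the subset may contain zero. Families are represented by the set of their
  members, since the sets below depend neither on the index set nor on repetitions.
\<close>

definition module_Vtilde ::
    "('a, 'c) ring_scheme \<Rightarrow> ('a, 'b, 'd) module_scheme \<Rightarrow> 'a set set \<Rightarrow> 'b set set" where
  "module_Vtilde R M \<S> =
     {P \<in> module_Spec R M. \<forall>S\<in>\<S>. submodule_colon R M P \<inter> S \<noteq> {}}"

definition module_Spec_tilde ::
    "('a, 'c) ring_scheme \<Rightarrow> ('a, 'b, 'd) module_scheme \<Rightarrow> 'b set topology" where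
  "module_Spec_tilde R M =
     topology (\<lambda>U. U \<subseteq> module_Spec R M \<and>
       (\<exists>\<S>. (\<forall>S\<in>\<S>. submonoid S R) \<and> module_Spec R M - U = module_Vtilde R M \<S>))"

text \<open>
  The remaining results show that these sets are indeed the closed sets of a topology on the whole
  spectrum, so that the constant above is not an unspecified value of type \<open>topology\<close>.
\<close>

lemma (in Module.module) prime_submodule_colon_primeideal:
  assumes "prime_submodule R M P"
  shows "primeideal (submodule_colon R M P) R"
proof -
  have sub: "submodule P R M" and proper: "P \<noteq> carrier M"
    and prime: "\<And>r m. \<lbrakk>r \<in> carrier R; m \<in> carrier M; r \<odot>\<^bsub>M\<^esub> m \<in> P\<rbrakk>
                  \<Longrightarrow> m \<in> P \<or> r \<in> submodule_colon R M P"
    using assms unfolding prime_submodule_def by auto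
  note subE = submoduleE[OF sub]
  have zeroP: "\<zero>\<^bsub>M\<^esub> \<in> P"
    using subE(1-3,5) by (metis M.r_neg ex_in_conv subsetD)
  show ?thesis
  proof (intro primeidealI idealI)
    show "ring R" "cring R" by unfold_locales
    show "subgroup (submodule_colon R M P) (add_monoid R)"
    proof (rule R.add.subgroupI)
      show "submodule_colon R M P \<noteq> {}"
        using zeroP by (auto simp: submodule_colon_def intro!: exI[of _ \<zero>])
    qed (auto simp: submodule_colon_def smult_l_minus smult_l_distr subE(3,5) simp flip: a_inv_def)
  next
    fix a x assume "a \<in> submodule_colon R M P" "x \<in> carrier R"
    thus "x \<otimes> a \<in> submodule_colon R M P" "a \<otimes> x \<in> submodule_colon R M P"
      by (auto simp: submodule_colon_def smult_assoc1 subE(4))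
  next
    have "\<one> \<notin> submodule_colon R M P"
      using proper subE(1) by (auto simp: submodule_colon_def)
    thus "carrier R \<noteq> submodule_colon R M P" by blast
  next
    fix a b
    assume ab: "a \<in> carrier R" "b \<in> carrier R" "a \<otimes> b \<in> submodule_colon R M P"
    show "a \<in> submodule_colon R M P \<or> b \<in> submodule_colon R M P"
    proof (rule disjCI)
      assume "b \<notin> submodule_colon R M P"
      then obtain m where m: "m \<in> carrier M" "b \<odot>\<^bsub>M\<^esub> m \<notin> P"
        using ab by (auto simp: submodule_colon_def)
      have "a \<odot>\<^bsub>M\<^esub> (b \<odot>\<^bsub>M\<^esub> m) \<in> P"
        using ab m by (auto simp: submodule_colon_def smult_assoc1)
      thus "a \<in> submodule_colon R M P"
        using prime[of a "b \<odot>\<^bsub>M\<^esub> m"] ab m by auto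
    qed
  qed
qed

lemma (in cring) submonoid_mult_image:
  assumes "submonoid S R" "submonoid T R"
  shows "submonoid ((\<lambda>(s, t). s \<otimes> t) ` (S \<times> T)) R"
proof -
  interpret S: submonoid S R by fact
  interpret T: submonoid T R by fact
  show ?thesis
  proof
    show "(\<lambda>(s, t). s \<otimes> t) ` (S \<times> T) \<subseteq> carrier R"
      using S.subset T.subset by auto
  next
    fix x y assume "x \<in> (\<lambda>(s, t). s \<otimes> t) ` (S \<times> T)" "y \<in> (\<lambda>(s, t). s \<otimes> t) ` (S \<times> T)"
    then obtain s t s' t' where *: "s \<in> S" "t \<in> T" "s' \<in> S" "t' \<in> T"
      "x = s \<otimes> t" "y = s' \<otimes> t'" by auto
    have "x \<otimes> y = (s \<otimes> s') \<otimes> (t \<otimes> t')"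
      using * S.mem_carrier T.mem_carrier by (simp add: m_ac)
    thus "x \<otimes> y \<in> (\<lambda>(s, t). s \<otimes> t) ` (S \<times> T)"
      using * by (auto intro!: image_eqI[where x = "(s \<otimes> s', t \<otimes> t')"])
  next
    show "\<one> \<in> (\<lambda>(s, t). s \<otimes> t) ` (S \<times> T)"
      by (auto intro!: image_eqI[where x = "(\<one>, \<one>)"])
  qed
qed

lemma (in Module.module) module_Vtilde_Un:
  assumes "\<forall>S\<in>\<S>. submonoid S R" "\<forall>T\<in>\<T>. submonoid T R"
  shows "module_Vtilde R M \<S> \<union> module_Vtilde R M \<T> =
    module_Vtilde R M {(\<lambda>(s, t). s \<otimes> t) ` (S \<times> T) | S T. S \<in> \<S> \<and> T \<in> \<T>}"
proof -
  have meet: "submodule_colon R M P \<inter> (\<lambda>(s, t). s \<otimes> t) ` (S \<times> T) \<noteq> {} \<longleftrightarrow>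
      submodule_colon R M P \<inter> S \<noteq> {} \<or> submodule_colon R M P \<inter> T \<noteq> {}"
    if P: "P \<in> module_Spec R M" and ST: "S \<in> \<S>" "T \<in> \<T>" for P S T
  proof -
    interpret I: primeideal "submodule_colon R M P" R
      using P prime_submodule_colon_primeideal by (simp add: module_Spec_def)
    interpret S: submonoid S R using assms ST by blast
    interpret T: submonoid T R using assms ST by blast
    show ?thesis
    proof
      assume "submodule_colon R M P \<inter> (\<lambda>(s, t). s \<otimes> t) ` (S \<times> T) \<noteq> {}"
      then obtain s t where "s \<in> S" "t \<in> T" "s \<otimes> t \<in> submodule_colon R M P" by auto
      thus "submodule_colon R M P \<inter> S \<noteq> {} \<or> submodule_colon R M P \<inter> T \<noteq> {}"
        using I.I_prime[of s t] by auto
    next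
      assume "submodule_colon R M P \<inter> S \<noteq> {} \<or> submodule_colon R M P \<inter> T \<noteq> {}"
      then obtain s t where "s \<in> S" "t \<in> T"
        "s \<in> submodule_colon R M P \<or> t \<in> submodule_colon R M P"
        using S.one_closed T.one_closed by blast
      moreover from this have "s \<otimes> t \<in> submodule_colon R M P"
        using I.I_l_closed I.I_r_closed S.mem_carrier T.mem_carrier by blast
      ultimately show "submodule_colon R M P \<inter> (\<lambda>(s, t). s \<otimes> t) ` (S \<times> T) \<noteq> {}"
        by force
    qed
  qed
  show ?thesis
  proof (rule Set.set_eqI)
    fix P
    show "P \<in> module_Vtilde R M \<S> \<union> module_Vtilde R M \<T> \<longleftrightarrow>
      P \<in> module_Vtilde R M {(\<lambda>(s, t). s \<otimes> t) ` (S \<times> T) | S T. S \<in> \<S> \<and> T \<in> \<T>}"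
    proof (cases "P \<in> module_Spec R M")
      case True
      have "P \<in> module_Vtilde R M {(\<lambda>(s, t). s \<otimes> t) ` (S \<times> T) | S T. S \<in> \<S> \<and> T \<in> \<T>} \<longleftrightarrow>
        (\<forall>S\<in>\<S>. \<forall>T\<in>\<T>. submodule_colon R M P \<inter> (\<lambda>(s, t). s \<otimes> t) ` (S \<times> T) \<noteq> {})"
        using True unfolding module_Vtilde_def by blast
      also have "\<dots> \<longleftrightarrow>
        (\<forall>S\<in>\<S>. \<forall>T\<in>\<T>. submodule_colon R M P \<inter> S \<noteq> {} \<or> submodule_colon R M P \<inter> T \<noteq> {})"
        using meet[OF True] by simp
      also have "\<dots> \<longleftrightarrow> P \<in> module_Vtilde R M \<S> \<union> module_Vtilde R M \<T>"
        using True unfolding module_Vtilde_def by blast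
      finally show ?thesis by simp
    qed (simp add: module_Vtilde_def)
  qed
qed

lemma (in Module.module) openin_module_Spec_tilde:
  "openin (module_Spec_tilde R M) U \<longleftrightarrow> U \<subseteq> module_Spec R M \<and>
     (\<exists>\<S>. (\<forall>S\<in>\<S>. submonoid S R) \<and> module_Spec R M - U = module_Vtilde R M \<S>)"
    (is "_ \<longleftrightarrow> ?L U")
proof -
  have "?L (U \<inter> U')" if U: "?L U" and U': "?L U'" for U U'
  proof -
    obtain \<S> \<T> where *: "\<forall>S\<in>\<S>. submonoid S R" "module_Spec R M - U = module_Vtilde R M \<S>"
      "\<forall>T\<in>\<T>. submonoid T R" "module_Spec R M - U' = module_Vtilde R M \<T>"
      using U U' by metis
    let ?W = "{(\<lambda>(s, t). s \<otimes> t) ` (S \<times> T) | S T. S \<in> \<S> \<and> T \<in> \<T>}"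
    have "module_Spec R M - U \<inter> U' = module_Vtilde R M ?W"
      using module_Vtilde_Un[OF *(1,3)] *(2,4) by blast
    moreover have "\<forall>W\<in>?W. submonoid W R"
      using *(1,3) R.submonoid_mult_image by blast
    ultimately show ?thesis using U by blast
  qed
  moreover have "?L (\<Union>\<K>)" if K: "\<forall>K\<in>\<K>. ?L K" for \<K>
  proof -
    obtain F where F: "\<And>K. K \<in> \<K> \<Longrightarrow>
        (\<forall>S\<in>F K. submonoid S R) \<and> module_Spec R M - K = module_Vtilde R M (F K)"
      using K by metis
    have "module_Spec R M - \<Union>\<K> = {P \<in> module_Spec R M. \<forall>K\<in>\<K>. P \<in> module_Spec R M - K}"
      by blast
    also have "\<dots> = {P \<in> module_Spec R M. \<forall>K\<in>\<K>. P \<in> module_Vtilde R M (F K)}"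
      using F by auto
    also have "\<dots> = module_Vtilde R M (\<Union>(F ` \<K>))"
      by (auto simp: module_Vtilde_def)
    finally have "module_Spec R M - \<Union>\<K> = module_Vtilde R M (\<Union>(F ` \<K>))" .
    moreover have "\<forall>S\<in>\<Union>(F ` \<K>). submonoid S R" using F by blast
    ultimately show ?thesis using K by blast
  qed
  ultimately have "istopology ?L" unfolding istopology_def by blast
  thus ?thesis by (simp add: module_Spec_tilde_def)
qed

lemma (in Module.module) topspace_module_Spec_tilde:
  "topspace (module_Spec_tilde R M) = module_Spec R M"
proof -
  have one: "submonoid {\<one>} R" by unfold_locales auto
  have "\<one> \<notin> submodule_colon R M P" if "P \<in> module_Spec R M" for P
  proof
    interpret I: primeideal "submodule_colon R M P" R
      using that prime_submodule_colon_primeideal by (simp add: module_Spec_def)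
    assume "\<one> \<in> submodule_colon R M P"
    thus False using I.one_imp_carrier I.I_notcarr by simp
  qed
  hence "module_Vtilde R M {{\<one>}} = {}" by (auto simp: module_Vtilde_def)
  hence "openin (module_Spec_tilde R M) (module_Spec R M)"
    using one by (auto simp: openin_module_Spec_tilde intro!: exI[of _ "{{\<one>}}"])
  thus ?thesis
    by (meson openin_subset openin_topspace openin_module_Spec_tilde subset_antisym)
qed

lemma (in Module.module) closedin_module_Spec_tilde:
  "closedin (module_Spec_tilde R M) C \<longleftrightarrow>
     (\<exists>\<S>. (\<forall>S\<in>\<S>. submonoid S R) \<and> C = module_Vtilde R M \<S>)"
proof -
  have "module_Vtilde R M \<S> \<subseteq> module_Spec R M" for \<S> by (auto simp: module_Vtilde_def)
  thus ?thesis
    by (auto simp: closedin_def topspace_module_Spec_tilde openin_module_Spec_tilde double_diff)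
qed

end

theory Submission
  imports Defs
begin

text \<open>
  Closed sets see a prime submodule \<open>P\<close> only through \<open>(P:M)\<close>. Conversely, if \<open>r\<close> lies in \<open>(P:M)\<close>
  but not in \<open>(Q:M)\<close>, then the complement of the prime ideal \<open>(Q:M)\<close> is multiplicatively closed,
  contains \<open>r\<close>, and so defines a closed set containing \<open>P\<close> but not \<open>Q\<close>.
\<close>

text \<open>Properness of \<open>I\<close> keeps 1 in the complement, and closure under products is
  the contrapositive of primeness.\<close>

lemma (in primeideal) submonoid_complement: "submonoid (carrier R - I) R"
proof
  show "carrier R - I \<subseteq> carrier R" by blast
  show "\<one> \<in> carrier R - I" using one_imp_carrier I_notcarr by auto
next
  fix x y assume "x \<in> carrier R - I" "y \<in> carrier R - I"
  then show "x \<otimes> y \<in> carrier R - I" using I_prime by auto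
qed

text \<open>Taking complements swaps open and closed sets and flips membership of both points, so it
  preserves separation. This form suits a topology specified by its closed sets.\<close>

lemma t0_space_closedin:
  "t0_space X \<longleftrightarrow> (\<forall>x\<in>topspace X. \<forall>y\<in>topspace X. x \<noteq> y \<longrightarrow>
     (\<exists>C. closedin X C \<and> (x \<notin> C \<longleftrightarrow> y \<in> C)))"
proof -
  have "(\<exists>U. openin X U \<and> (x \<notin> U \<longleftrightarrow> y \<in> U)) \<longleftrightarrow> (\<exists>C. closedin X C \<and> (x \<notin> C \<longleftrightarrow> y \<in> C))"
    if xy: "x \<in> topspace X" "y \<in> topspace X" for x y
  proof
    assume "\<exists>U. openin X U \<and> (x \<notin> U \<longleftrightarrow> y \<in> U)"
    then obtain U where "openin X U" "x \<notin> U \<longleftrightarrow> y \<in> U" by blast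
    then show "\<exists>C. closedin X C \<and> (x \<notin> C \<longleftrightarrow> y \<in> C)"
      using xy by (intro exI[of _ "topspace X - U"]) blast
  next
    assume "\<exists>C. closedin X C \<and> (x \<notin> C \<longleftrightarrow> y \<in> C)"
    then obtain C where "closedin X C" "x \<notin> C \<longleftrightarrow> y \<in> C" by blast
    then show "\<exists>U. openin X U \<and> (x \<notin> U \<longleftrightarrow> y \<in> U)"
      using xy by (intro exI[of _ "topspace X - C"]) blast
  qed
  then show ?thesis by (simp add: t0_space_def cong: ball_cong)
qed

lemma submodule_colon_subset: "submodule_colon R M N \<subseteq> carrier R"
  unfolding submodule_colon_def by blast

lemma (in Module.module) closedin_separating_prime_submodules:
  assumes P: "P \<in> module_Spec R M" and Q: "Q \<in> module_Spec R M"
    and not_subset: "\<not> submodule_colon R M P \<subseteq> submodule_colon R M Q"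
  shows "\<exists>C. closedin (module_Spec_tilde R M) C \<and> P \<in> C \<and> Q \<notin> C"
proof -
  let ?S = "carrier R - submodule_colon R M Q"
  have "submonoid ?S R"
    using Q prime_submodule_colon_primeideal
    by (intro primeideal.submonoid_complement) (simp add: module_Spec_def)
  then have "closedin (module_Spec_tilde R M) (module_Vtilde R M {?S})"
    by (auto simp: closedin_module_Spec_tilde)
  moreover have "P \<in> module_Vtilde R M {?S}"
    \<comment> \<open>Any r in (P:M) outside (Q:M) lies in \<open>carrier R\<close>, hence in
      \<open>?S\<close>, so \<open>?S\<close> meets (P:M).\<close>
    using P not_subset submodule_colon_subset[of R M P] unfolding module_Vtilde_def by blast
  moreover have "Q \<notin> module_Vtilde R M {?S}"
    by (simp add: module_Vtilde_def)
  ultimately show ?thesis by blast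
qed

text \<open>The T0 condition for a single pair of points; quantifying over distinct pairs then gives
  the theorem.\<close>

lemma (in Module.module) module_Spec_tilde_distinguishable_iff:
  assumes P: "P \<in> module_Spec R M" and Q: "Q \<in> module_Spec R M"
  shows "(\<exists>C. closedin (module_Spec_tilde R M) C \<and> (P \<notin> C \<longleftrightarrow> Q \<in> C)) \<longleftrightarrow>
    submodule_colon R M P \<noteq> submodule_colon R M Q"
proof
  assume "\<exists>C. closedin (module_Spec_tilde R M) C \<and> (P \<notin> C \<longleftrightarrow> Q \<in> C)"
  then obtain \<S> where "P \<notin> module_Vtilde R M \<S> \<longleftrightarrow> Q \<in> module_Vtilde R M \<S>"
    by (auto simp: closedin_module_Spec_tilde)
  then show "submodule_colon R M P \<noteq> submodule_colon R M Q"
    using P Q by (auto simp: module_Vtilde_def)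
next
  assume "submodule_colon R M P \<noteq> submodule_colon R M Q"
  \<comment> \<open>Two different sets fail to be included in at least one direction. Since either
    point may be the one in \<open>C\<close>, both directions serve.\<close>
  then show "\<exists>C. closedin (module_Spec_tilde R M) C \<and> (P \<notin> C \<longleftrightarrow> Q \<in> C)"
    using closedin_separating_prime_submodules[OF P Q]
      closedin_separating_prime_submodules[OF Q P] by blast
qed

theorem theorem8:
  fixes R :: "('a, 'c) ring_scheme" and M :: "('a, 'b, 'd) module_scheme"
  assumes "Module.module R M"
    and "module_Spec R M \<noteq> {}"
  shows "t0_space (module_Spec_tilde R M) \<longleftrightarrow>
    (\<forall>P\<in>module_Spec R M. \<forall>Q\<in>module_Spec R M.
       P \<noteq> Q \<longrightarrow> submodule_colon R M P \<noteq> submodule_colon R M Q)"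
proof -
  interpret Module.module R M by fact
  show ?thesis
    by (simp add: t0_space_closedin topspace_module_Spec_tilde
        module_Spec_tilde_distinguishable_iff)
qed

end
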